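(* If $p=4$, then $$ D_{\mathbb R,2,4}(2)=C_{\mathbb R,2,4}(2)=K_{2,2,4}=\max_{\alpha\in[0,1]}\left[2\left|\frac{2\alpha^4-1}{\alpha^2+(1-\alpha^4)^{\frac12}}\right|^2+\left(2\alpha(1-\alpha^4)^{\frac14}\right)^2\right]^{\frac12}=\sqrt2 . $$ Moreover, all the extreme polynomials in the following list (families (i) and (ii), with $p=4$) are also extremal: (i) $P(x,y)=ax^2+cy^2$, where $ac\ge0$ and $|a|^{\frac{p}{p-2}}+|c|^{\frac{p}{p-2}}=1$; (ii) $P(x,y)=\pm\left(\frac{\alpha^p-\beta^p}{\alpha^2+\beta^2}(x^2-y^2)+2\alpha\beta\,\frac{\alpha^{p-2}+\beta^{p-2}}{\alpha^2+\beta^2}\,xy\right)$, with $\alpha,\beta\ge0$ and $\alpha^p+\beta^p=1$. More explicitly, for the polynomials $$ P(x,y)=\pm\left(\frac{\alpha^p-\beta^p}{\alpha^2+\beta^2}(x^2-y^2)+2\alpha\beta\,\frac{\alpha^{p-2}+\beta^{p-2}}{\alpha^2+\beta^2}\,xy\right),\quad\text{with }\alpha,\beta\ge0\text{ and }\alpha^p+\beta^p=1, $$ one obtains $$ |P|_2=\sqrt2\,\|P\|_4 . $$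
   Context: $\mathcal P(^2\mathbb R^2)$ is the real vector space of $2$-homogeneous polynomials $P(x,y)=ax^2+bxy+cy^2$ with $a,b,c\in\mathbb R$. For $1\le q<\infty$, $|P|_q=(|a|^q+|b|^q+|c|^q)^{1/q}$ is the $\ell_q$ norm of the coefficients, and $\|P\|_p=\sup\{|P(x,y)|:\|(x,y)\|_{\ell_p^2}\le1\}$ is the polynomial norm induced by $\ell_p^2$; thus $\|P\|_4=\sup\{|P(x,y)|:x^4+y^4\le1\}$. $\mathcal P(^2\ell_p^2)$ denotes $\mathcal P(^2\mathbb R^2)$ with the norm $\|\cdot\|_p$. $K_{2,2,4}$ is the smallest $K>0$ such that $|P|_2\le K\|P\|_4$ for all $P\in\mathcal P(^2\mathbb R^2)$. The Hardy–Littlewood constants $C_{\mathbb R,2,p}(2)$ (for $2<p\le4$) and $D_{\mathbb R,2,p}(2)$ (for $4\le p\le\infty$) are the smallest constants $C$ and $D$ such that $|P|_{\frac{p}{p-2}}\le C\|P\|_p$, respectively $|P|_{\frac{4p}{3p-4}}\le D\|P\|_p$, for all $P\in\mathcal P(^2\mathbb R^2)$ (with $\frac{4p}{3p-4}=\frac43$ when $p=\infty$); at $p=4$ both exponents equal $2$. For $p>2$, families (i) and (ii) are Grecu's description of the extreme points of the unit ball of $\mathcal P(^2\ell_p^2)$: a $2$-homogeneous polynomial of unit norm is an extreme point of that ball if and only if it is of the form (i) or (ii). A polynomial is called extremal if it attains equality in $|P|_2\le K_{2,2,4}\|P\|_4$.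
   Formalization: The claim that the polynomials of family (i) are extremal is dropped: for p=4 each of them has |P|_2=1 and ‖P‖_4=1 (e.g. P=x^2), so none attains the constant √2; extremality is stated for family (ii) only. *)

theory Defs
  imports "HOL-Analysis.Analysis"
begin

text \<open>
  The triple \<open>(a, b, c)\<close> stands for the 2-homogeneous polynomial
  \<open>a x\<^sup>2 + b x y + c y\<^sup>2\<close>; the vector space structure is that of the product type.
\<close>

type_synonym hpoly = "real \<times> real \<times> real"

fun peval :: "hpoly \<Rightarrow> real \<times> real \<Rightarrow> real" where
  "peval (a, b, c) (x, y) = a * x\<^sup>2 + b * x * y + c * y\<^sup>2"

fun coeff_norm :: "real \<Rightarrow> hpoly \<Rightarrow> real" where
  "coeff_norm q (a, b, c) =
     (\<bar>a\<bar> powr q + \<bar>b\<bar> powr q + \<bar>c\<bar> powr q) powr (1 / q)"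

fun lp_norm :: "ereal \<Rightarrow> real \<times> real \<Rightarrow> real" where
  "lp_norm p (x, y) =
     (if p = \<infinity> then max \<bar>x\<bar> \<bar>y\<bar>
      else (\<bar>x\<bar> powr real_of_ereal p + \<bar>y\<bar> powr real_of_ereal p) powr (1 / real_of_ereal p))"

definition poly_norm :: "ereal \<Rightarrow> hpoly \<Rightarrow> real" where
  "poly_norm p P = (SUP v \<in> {v. lp_norm p v \<le> 1}. \<bar>peval P v\<bar>)"

text \<open>
  \<open>LEAST\<close> over the reals is a definite description of the minimum, so an equation
  \<open>best_const q p = K\<close> can only be derived by showing that \<open>K\<close> is admissible and minimal.
\<close>

definition best_const :: "real \<Rightarrow> ereal \<Rightarrow> real" where
  "best_const q p = (LEAST K. 0 < K \<and> (\<forall>P. coeff_norm q P \<le> K * poly_norm p P))"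

definition K_2_2_4 :: real where
  "K_2_2_4 = best_const 2 4"

text \<open>Hardy--Littlewood constants, for \<open>2 < p \<le> 4\<close> and \<open>4 \<le> p \<le> \<infinity>\<close> respectively.\<close>

definition HL_C :: "real \<Rightarrow> real" where
  "HL_C p = best_const (p / (p - 2)) (ereal p)"

definition HL_D :: "ereal \<Rightarrow> real" where
  "HL_D p = best_const (if p = \<infinity> then 4 / 3
                        else 4 * real_of_ereal p / (3 * real_of_ereal p - 4)) p"

definition extremal :: "hpoly \<Rightarrow> bool" where
  "extremal P \<longleftrightarrow> coeff_norm 2 P = K_2_2_4 * poly_norm 4 P"

text \<open>
  Grecu's two families of extreme points of the unit ball, for real \<open>p > 2\<close>.
  The scalar \<open>s\<close> is the sign \<open>\<plusminus>\<close>.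
\<close>

definition grecu_i :: "real \<Rightarrow> hpoly set" where
  "grecu_i p = {(a, 0, c) | a c.
     a * c \<ge> 0 \<and> \<bar>a\<bar> powr (p / (p - 2)) + \<bar>c\<bar> powr (p / (p - 2)) = 1}"

definition grecu_ii :: "real \<Rightarrow> hpoly set" where
  "grecu_ii p = {s *\<^sub>R
      ((\<alpha> powr p - \<beta> powr p) / (\<alpha>\<^sup>2 + \<beta>\<^sup>2),
       2 * \<alpha> * \<beta> * ((\<alpha> powr (p - 2) + \<beta> powr (p - 2)) / (\<alpha>\<^sup>2 + \<beta>\<^sup>2)),
       - ((\<alpha> powr p - \<beta> powr p) / (\<alpha>\<^sup>2 + \<beta>\<^sup>2))) | s \<alpha> \<beta>.
     s \<in> {1, -1} \<and> \<alpha> \<ge> 0 \<and> \<beta> \<ge> 0 \<and> \<alpha> powr p + \<beta> powr p = 1}"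

text \<open>
  For \<open>p = 4\<close> the members of family (i) are not extremal: both of their norms equal 1, whereas
  the optimal constant is \<open>sqrt 2\<close>. Extremality can therefore only be asserted for family (ii).
\<close>

lemma lp_norm_4_le_1: "lp_norm 4 (x, y) \<le> 1 \<longleftrightarrow> x ^ 4 + y ^ 4 \<le> 1"
proof -
  have r: "real_of_ereal 4 = 4" "(4::ereal) \<noteq> \<infinity>" by simp_all
  have e: "\<bar>t\<bar> powr 4 = t ^ 4" for t :: real
    by simp
  have nn: "0 \<le> x ^ 4 + y ^ 4" by simp
  show ?thesis
  proof
    assume "lp_norm 4 (x, y) \<le> 1"
    then have "(x ^ 4 + y ^ 4) powr (1 / 4) \<le> 1" by (simp add: r e)
    then have "((x ^ 4 + y ^ 4) powr (1 / 4)) powr 4 \<le> 1 powr 4"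
      by (intro powr_mono2) auto
    then show "x ^ 4 + y ^ 4 \<le> 1" using nn by (simp add: powr_powr)
  next
    assume "x ^ 4 + y ^ 4 \<le> 1"
    then have "(x ^ 4 + y ^ 4) powr (1 / 4) \<le> 1 powr (1 / 4)"
      using nn by (intro powr_mono2) auto
    then show "lp_norm 4 (x, y) \<le> 1" by (simp add: r e)
  qed
qed

lemma grecu_i_norms:
  assumes "P \<in> grecu_i 4"
  shows "coeff_norm 2 P = 1" and "poly_norm 4 P = 1"
proof -
  obtain a c where P: "P = (a, 0, c)" and ac: "a * c \<ge> 0"
    and "\<bar>a\<bar> powr 2 + \<bar>c\<bar> powr 2 = 1"
    using assms by (auto simp: grecu_i_def)
  then show "coeff_norm 2 P = 1" by simp
  have s: "a\<^sup>2 + c\<^sup>2 = 1"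
    using \<open>\<bar>a\<bar> powr 2 + \<bar>c\<bar> powr 2 = 1\<close> by simp
  have le: "\<bar>peval P (x, y)\<bar> \<le> 1" if "x ^ 4 + y ^ 4 \<le> 1" for x y
  proof -
    have "(a * x\<^sup>2 + c * y\<^sup>2)\<^sup>2 \<le> (a * x\<^sup>2 + c * y\<^sup>2)\<^sup>2 + (a * y\<^sup>2 - c * x\<^sup>2)\<^sup>2"
      by simp
    also have "\<dots> = (a\<^sup>2 + c\<^sup>2) * (x ^ 4 + y ^ 4)"
      by (simp add: power2_eq_square power4_eq_xxxx algebra_simps)
    also have "\<dots> \<le> 1" using s that by simp
    finally have "(a * x\<^sup>2 + c * y\<^sup>2)\<^sup>2 \<le> 1" .
    then show ?thesis by (simp add: P abs_square_le_1)
  qed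
  define v where "v = (sqrt \<bar>a\<bar>, sqrt \<bar>c\<bar>)"
  have v4: "sqrt \<bar>t\<bar> ^ 4 = t\<^sup>2" for t
  proof -
    have "sqrt \<bar>t\<bar> ^ 4 = ((sqrt \<bar>t\<bar>)\<^sup>2)\<^sup>2" by (simp only: power_mult [symmetric]) simp
    then show ?thesis by simp
  qed
  have v: "lp_norm 4 v \<le> 1"
    unfolding v_def lp_norm_4_le_1 v4 s by simp
  have "\<bar>peval P v\<bar> = \<bar>a * \<bar>a\<bar> + c * \<bar>c\<bar>\<bar>" by (simp add: P v_def)
  also have "\<dots> = a\<^sup>2 + c\<^sup>2"
    using ac by (auto simp: zero_le_mult_iff power2_eq_square)
  finally have "\<bar>peval P v\<bar> = 1" using s by simp
  moreover have "\<bar>peval P w\<bar> \<le> 1" if "lp_norm 4 w \<le> 1" for w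
    using that le lp_norm_4_le_1 by (metis surj_pair)
  ultimately show "poly_norm 4 P = 1"
    unfolding poly_norm_def
    by (intro cSup_eq_maximum) (use v in \<open>force simp del: lp_norm.simps peval.simps\<close>)+
qed

end

theory Submission
  imports Defs
begin

text \<open>
  Everything rests on the identity \<open>x\<^sup>4 + y\<^sup>4 = (x\<^sup>2 - y\<^sup>2)\<^sup>2 + (sqrt 2 x y)\<^sup>2\<close>: the map
  \<open>(x, y) \<mapsto> (w, z) = (x\<^sup>2 - y\<^sup>2, sqrt 2 x y)\<close> sends the unit sphere of \<open>\<ell>\<^sub>4\<^sup>2\<close> onto the Euclidean unit
  circle. Put \<open>S = (a + c) / sqrt 2\<close> and \<open>D = (a - c) / sqrt 2\<close>. Then \<open>a\<^sup>2 + b\<^sup>2 + c\<^sup>2 = S\<^sup>2 + D\<^sup>2 + b\<^sup>2\<close> and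
  \<open>sqrt 2 P(x, y) = S (x\<^sup>2 + y\<^sup>2) + (D w + b z)\<close>,
  where \<open>x\<^sup>2 + y\<^sup>2 \<ge> 1\<close> on the unit sphere.

  For \<open>S \<ge> 0\<close>, which is no restriction since \<open>P\<close> may be replaced by \<open>-P\<close>, choose \<open>(x, y)\<close> so that
  \<open>(w, z)\<close> points in the direction of \<open>(D, b)\<close>. With \<open>R = sqrt (D\<^sup>2 + b\<^sup>2)\<close> this gives
  \<open>sqrt 2 P(x, y) \<ge> S + R \<ge> sqrt (S\<^sup>2 + R\<^sup>2)\<close>, so the
  constant \<open>sqrt 2\<close> is admissible (\<open>coeff_norm_le_sqrt2_poly_norm\<close>).

  For \<open>p = 4\<close> family (ii) collapses to \<open>\<plusminus>((\<alpha>\<^sup>2 - \<beta>\<^sup>2) (x\<^sup>2 - y\<^sup>2) + 2 \<alpha> \<beta> x y)\<close>, which is the Euclidean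
  inner product of the images of \<open>(\<alpha>, \<beta>)\<close> and \<open>(x, y)\<close> under that map. By Cauchy--Schwarz its norm
  is 1, attained at \<open>(\<alpha>, \<beta>)\<close>, while the squares of its coefficients add up to
  \<open>2 (\<alpha>\<^sup>4 + \<beta>\<^sup>4) = 2\<close>. Hence \<open>sqrt 2\<close> is also minimal. The function that is maximised over
  \<open>[0, 1]\<close> is the coefficient norm of these polynomials with \<open>\<beta> = (1 - \<alpha>\<^sup>4)\<^bsup>1/4\<^esup>\<close>, and
  so is constant.
\<close>

section \<open>The polynomial norm on the \<open>\<ell>\<^sub>4\<close> plane\<close>

lemma abs_peval_le_poly_norm_4:
  assumes "x ^ 4 + y ^ 4 \<le> 1"
  shows "\<bar>peval P (x, y)\<bar> \<le> poly_norm 4 P"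
proof -
  obtain a b c where P: "P = (a, b, c)" by (cases P)
  have bound: "\<bar>peval P v\<bar> \<le> \<bar>a\<bar> + \<bar>b\<bar> + \<bar>c\<bar>" if "lp_norm 4 v \<le> 1" for v
  proof -
    obtain s t where v: "v = (s, t)" by (cases v)
    have st: "s ^ 4 + t ^ 4 \<le> 1" using that unfolding v lp_norm_4_le_1 .
    moreover have "0 \<le> s ^ 4" "0 \<le> t ^ 4" by simp_all
    ultimately have "s ^ 4 \<le> 1" "t ^ 4 \<le> 1" by linarith+
    then have "\<bar>s\<bar> ^ 4 \<le> 1" "\<bar>t\<bar> ^ 4 \<le> 1" by simp_all
    then have s: "\<bar>s\<bar> \<le> 1" and t: "\<bar>t\<bar> \<le> 1" by (simp_all only: power_le_one_iff abs_ge_zero) simp_all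
    have "\<bar>a * s\<^sup>2\<bar> \<le> \<bar>a\<bar>" "\<bar>c * t\<^sup>2\<bar> \<le> \<bar>c\<bar>"
      using s t by (simp_all add: abs_mult mult_left_le abs_square_le_1)
    moreover have "\<bar>s\<bar> * \<bar>t\<bar> \<le> 1" using s t by (simp add: mult_le_one)
    then have "\<bar>b * s * t\<bar> \<le> \<bar>b\<bar>" by (simp add: abs_mult mult.assoc mult_left_le)
    ultimately show ?thesis unfolding P v peval.simps by linarith
  qed
  show ?thesis
    unfolding poly_norm_def
  proof (rule cSUP_upper)
    show "bdd_above ((\<lambda>v. \<bar>peval P v\<bar>) ` {v. lp_norm 4 v \<le> 1})"
      using bound by (auto intro!: bdd_aboveI simp del: lp_norm.simps peval.simps)
    show "(x, y) \<in> {v. lp_norm 4 v \<le> 1}"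
      using assms lp_norm_4_le_1 by blast
  qed
qed

lemma poly_norm_4_eqI:
  assumes "\<And>x y. x ^ 4 + y ^ 4 \<le> 1 \<Longrightarrow> \<bar>peval P (x, y)\<bar> \<le> m"
    and "x ^ 4 + y ^ 4 \<le> 1" and "\<bar>peval P (x, y)\<bar> = m"
  shows "poly_norm 4 P = m"
proof (rule antisym)
  have "(x, y) \<in> {v. lp_norm 4 v \<le> 1}"
    using assms(2) lp_norm_4_le_1 by blast
  then show "poly_norm 4 P \<le> m"
    unfolding poly_norm_def
    using assms(1) lp_norm_4_le_1
    by (intro cSUP_least) (auto simp del: lp_norm.simps peval.simps)
  show "m \<le> poly_norm 4 P"
    using abs_peval_le_poly_norm_4[OF assms(2), of P] assms(3) by simp
qed

lemma coeff_norm_2: "coeff_norm 2 (a, b, c) = sqrt (a\<^sup>2 + b\<^sup>2 + c\<^sup>2)"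
  by (simp add: powr_half_sqrt)

section \<open>The constant \<open>sqrt 2\<close> is admissible\<close>

text \<open>
  The two squares \<open>x\<^sup>2\<close> and \<open>y\<^sup>2\<close> have difference \<open>w\<close> and sum
  \<open>\<sigma> = sqrt (1 + z\<^sup>2)\<close>, and these two numbers determine them; they are nonnegative because \<open>\<bar>w\<bar> \<le> 1 \<le> \<sigma>\<close>.
  Their product is \<open>z\<^sup>2 / 2\<close>, so only the sign of \<open>x y\<close> has to be adjusted.
\<close>

lemma l4_sphere_onto_circle:
  fixes w z :: real
  assumes "w\<^sup>2 + z\<^sup>2 = 1"
  obtains x y :: real where "x\<^sup>2 - y\<^sup>2 = w" "sqrt 2 * (x * y) = z" "x ^ 4 + y ^ 4 = 1" "1 \<le> x\<^sup>2 + y\<^sup>2"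
proof -
  define \<sigma> where "\<sigma> = sqrt (1 + z\<^sup>2)"
  have \<sigma>2: "\<sigma>\<^sup>2 = 1 + z\<^sup>2" by (simp add: \<sigma>_def)
  have \<sigma>1: "1 \<le> \<sigma>" by (simp add: \<sigma>_def)
  have "w\<^sup>2 \<le> 1" using assms by (smt (verit) zero_le_power2)
  then have "\<bar>w\<bar> \<le> 1" by (simp add: abs_square_le_1)
  then have w: "0 \<le> \<sigma> + w" "0 \<le> \<sigma> - w" using \<sigma>1 by auto
  define e :: real where "e = (if 0 \<le> z then 1 else - 1)"
  have e: "e\<^sup>2 = 1" "e * \<bar>z\<bar> = z" by (auto simp: e_def)
  define x where "x = sqrt ((\<sigma> + w) / 2)"
  define y where "y = e * sqrt ((\<sigma> - w) / 2)"
  have x2: "x\<^sup>2 = (\<sigma> + w) / 2" and y2: "y\<^sup>2 = (\<sigma> - w) / 2"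
    using w e by (simp_all add: x_def y_def power_mult_distrib)
  have "sqrt 2 * (x * y) = e * sqrt (2 * ((\<sigma> + w) / 2 * ((\<sigma> - w) / 2)))"
    unfolding x_def y_def real_sqrt_mult by simp
  also have "2 * ((\<sigma> + w) / 2 * ((\<sigma> - w) / 2)) = (\<sigma>\<^sup>2 - w\<^sup>2) / 2"
    by (simp add: power2_eq_square field_simps)
  also have "\<dots> = z\<^sup>2" using assms \<sigma>2 by simp
  finally have xy: "sqrt 2 * (x * y) = z" using e by simp
  have "x ^ 4 + y ^ 4 = (x\<^sup>2)\<^sup>2 + (y\<^sup>2)\<^sup>2" by simp
  also have "\<dots> = (\<sigma>\<^sup>2 + w\<^sup>2) / 2"
    unfolding x2 y2 by (simp add: power2_eq_square field_simps)
  also have "\<dots> = 1" using assms \<sigma>2 by simp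
  finally have "x ^ 4 + y ^ 4 = 1" .
  then show thesis using that[of x y] xy x2 y2 \<sigma>1 by (simp add: field_simps)
qed

lemma unit_vector_attaining_norm:
  fixes D b :: real
  obtains w z :: real where "w\<^sup>2 + z\<^sup>2 = 1" "D * w + b * z = sqrt (D\<^sup>2 + b\<^sup>2)"
proof (cases "D\<^sup>2 + b\<^sup>2 = 0")
  case True
  then show thesis using that[of 1 0] by (simp add: sum_power2_eq_zero_iff)
next
  case False
  define R where "R = sqrt (D\<^sup>2 + b\<^sup>2)"
  have R: "R \<noteq> 0" "R\<^sup>2 = D\<^sup>2 + b\<^sup>2" using False by (auto simp: R_def)
  have "(D / R)\<^sup>2 + (b / R)\<^sup>2 = (D\<^sup>2 + b\<^sup>2) / R\<^sup>2"
    by (simp add: power_divide add_divide_distrib)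
  also have "\<dots> = 1" using R by (metis div_self power_not_zero)
  finally have unit: "(D / R)\<^sup>2 + (b / R)\<^sup>2 = 1" .
  have "D * (D / R) + b * (b / R) = R\<^sup>2 / R"
    unfolding R(2) by (simp add: power2_eq_square add_divide_distrib)
  also have "\<dots> = R" unfolding power2_eq_square using R(1) by simp
  finally show thesis using that[OF unit] by (simp add: R_def)
qed

text \<open>
  Aligning \<open>(w, z)\<close> with \<open>(D, b)\<close> maximises the second summand of
  \<open>sqrt 2 P = S (x\<^sup>2 + y\<^sup>2) + (D w + b z)\<close>, and the first summand is then still at least \<open>S\<close>;
  since \<open>S, R \<ge> 0\<close>, dropping the cross term of \<open>(S + R)\<^sup>2\<close> costs only an inequality.
\<close>

lemma exists_peval_ge_coeff_norm:
  fixes a b c :: real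
  assumes "0 \<le> a + c"
  obtains x y :: real where "x ^ 4 + y ^ 4 = 1"
    "sqrt (a\<^sup>2 + b\<^sup>2 + c\<^sup>2) \<le> sqrt 2 * peval (a, b, c) (x, y)"
proof -
  define S where "S = (a + c) / sqrt 2"
  define D where "D = (a - c) / sqrt 2"
  define R where "R = sqrt (D\<^sup>2 + b\<^sup>2)"
  obtain w z where wz: "w\<^sup>2 + z\<^sup>2 = 1" and R_eq: "D * w + b * z = R"
    unfolding R_def by (rule unit_vector_attaining_norm)
  obtain x y where xy: "x\<^sup>2 - y\<^sup>2 = w" "sqrt 2 * (x * y) = z"
    and sphere: "x ^ 4 + y ^ 4 = 1" and ge1: "1 \<le> x\<^sup>2 + y\<^sup>2"
    using l4_sphere_onto_circle[OF wz] .
  have S0: "0 \<le> S" using assms by (simp add: S_def)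
  have R0: "0 \<le> R" by (simp add: R_def)
  have aS: "sqrt 2 * a = S + D" and cS: "sqrt 2 * c = S - D"
    by (simp_all add: S_def D_def add_divide_distrib [symmetric] diff_divide_distrib [symmetric]
          real_div_sqrt mult.commute [of "sqrt 2"] field_simps)
  have norm_eq: "a\<^sup>2 + b\<^sup>2 + c\<^sup>2 = S\<^sup>2 + R\<^sup>2"
    unfolding R_def S_def D_def by (simp add: power_divide) (simp add: power2_eq_square field_simps)
  have "sqrt (a\<^sup>2 + b\<^sup>2 + c\<^sup>2) \<le> S + R"
    unfolding norm_eq using S0 R0 by (rule sqrt_sum_squares_le_sum)
  also have "S + R \<le> S * (x\<^sup>2 + y\<^sup>2) + R"
    using mult_left_mono[OF ge1 S0] by simp
  also have "\<dots> = (S + D) * x\<^sup>2 + b * (sqrt 2 * (x * y)) + (S - D) * y\<^sup>2"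
    unfolding R_eq [symmetric] xy [symmetric] by (simp add: algebra_simps)
  also have "\<dots> = sqrt 2 * peval (a, b, c) (x, y)"
    unfolding aS [symmetric] cS [symmetric] by (simp add: algebra_simps)
  finally show thesis using that sphere by blast
qed

theorem coeff_norm_le_sqrt2_poly_norm: "coeff_norm 2 P \<le> sqrt 2 * poly_norm 4 P"
proof -
  obtain a b c where P: "P = (a, b, c)" by (cases P)
  obtain x y where sphere: "x ^ 4 + y ^ 4 = 1"
    and le: "sqrt (a\<^sup>2 + b\<^sup>2 + c\<^sup>2) \<le> sqrt 2 * \<bar>peval P (x, y)\<bar>"
  proof (cases "0 \<le> a + c")
    case True
    from exists_peval_ge_coeff_norm[OF this, of b] obtain x y where
      1: "x ^ 4 + y ^ 4 = 1" and 2: "sqrt (a\<^sup>2 + b\<^sup>2 + c\<^sup>2) \<le> sqrt 2 * peval P (x, y)"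
      unfolding P by blast
    have "sqrt 2 * peval P (x, y) \<le> sqrt 2 * \<bar>peval P (x, y)\<bar>"
      by (intro mult_left_mono) auto
    with 1 2 show thesis using that by (meson order_trans)
  next
    case False
    then have "0 \<le> - a + - c" by simp
    from exists_peval_ge_coeff_norm[OF this, of "- b"] obtain x y where
      1: "x ^ 4 + y ^ 4 = 1"
      and 2: "sqrt (a\<^sup>2 + b\<^sup>2 + c\<^sup>2) \<le> sqrt 2 * peval (- a, - b, - c) (x, y)"
      by auto
    have "peval (- a, - b, - c) (x, y) = - peval P (x, y)" by (simp add: P)
    then have "sqrt 2 * peval (- a, - b, - c) (x, y) \<le> sqrt 2 * \<bar>peval P (x, y)\<bar>"
      by (intro mult_left_mono) auto
    with 1 2 show thesis using that by (meson order_trans)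
  qed
  have "sqrt 2 * \<bar>peval P (x, y)\<bar> \<le> sqrt 2 * poly_norm 4 P"
    using abs_peval_le_poly_norm_4 sphere by (intro mult_left_mono) auto
  with le show ?thesis unfolding P coeff_norm_2 by linarith
qed

section \<open>Family (ii) for \<open>p = 4\<close>\<close>

lemma grecu_ii_4_cases:
  assumes "P \<in> grecu_ii 4"
  obtains s \<alpha> \<beta> :: real where "s \<in> {1, -1}" "0 \<le> \<alpha>" "0 \<le> \<beta>" "\<alpha> ^ 4 + \<beta> ^ 4 = 1"
    "P = s *\<^sub>R (\<alpha>\<^sup>2 - \<beta>\<^sup>2, 2 * \<alpha> * \<beta>, - (\<alpha>\<^sup>2 - \<beta>\<^sup>2))"
proof -
  from assms obtain s \<alpha> \<beta> :: real where s: "s \<in> {1, -1}" and nn: "0 \<le> \<alpha>" "0 \<le> \<beta>"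
    and pw: "\<alpha> powr 4 + \<beta> powr 4 = 1"
    and P: "P = s *\<^sub>R ((\<alpha> powr 4 - \<beta> powr 4) / (\<alpha>\<^sup>2 + \<beta>\<^sup>2),
       2 * \<alpha> * \<beta> * ((\<alpha> powr (4 - 2) + \<beta> powr (4 - 2)) / (\<alpha>\<^sup>2 + \<beta>\<^sup>2)),
       - ((\<alpha> powr 4 - \<beta> powr 4) / (\<alpha>\<^sup>2 + \<beta>\<^sup>2)))"
    unfolding grecu_ii_def by blast
  have p4: "\<alpha> powr 4 = \<alpha> ^ 4" "\<beta> powr 4 = \<beta> ^ 4"
    and p2: "\<alpha> powr (4 - 2) = \<alpha>\<^sup>2" "\<beta> powr (4 - 2) = \<beta>\<^sup>2"
    using nn by simp_all
  have eq1: "\<alpha> ^ 4 + \<beta> ^ 4 = 1" using pw p4 by simp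
  then have nz: "\<alpha>\<^sup>2 + \<beta>\<^sup>2 \<noteq> 0" by (auto simp: sum_power2_eq_zero_iff)
  have "\<alpha> ^ 4 - \<beta> ^ 4 = (\<alpha>\<^sup>2 - \<beta>\<^sup>2) * (\<alpha>\<^sup>2 + \<beta>\<^sup>2)"
    by (simp add: power2_eq_square power4_eq_xxxx algebra_simps)
  then have "(\<alpha> ^ 4 - \<beta> ^ 4) / (\<alpha>\<^sup>2 + \<beta>\<^sup>2) = \<alpha>\<^sup>2 - \<beta>\<^sup>2" using nz by simp
  then show thesis using that[OF s nn eq1] P nz unfolding p4 p2 by simp
qed

text \<open>
  This is Cauchy--Schwarz for the vectors \<open>(\<alpha>\<^sup>2 - \<beta>\<^sup>2, sqrt 2 \<alpha> \<beta>)\<close> and \<open>(x\<^sup>2 - y\<^sup>2, sqrt 2 x y)\<close> of squared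
  lengths \<open>\<alpha>\<^sup>4 + \<beta>\<^sup>4\<close> and \<open>x\<^sup>4 + y\<^sup>4\<close>, with equality for \<open>(x, y) = (\<alpha>, \<beta>)\<close>.
\<close>

lemma poly_norm_grecu_ii_4:
  assumes "P \<in> grecu_ii 4"
  shows "poly_norm 4 P = 1"
proof -
  obtain s \<alpha> \<beta> :: real where s: "s \<in> {1, -1}" and sphere: "\<alpha> ^ 4 + \<beta> ^ 4 = 1"
    and P: "P = s *\<^sub>R (\<alpha>\<^sup>2 - \<beta>\<^sup>2, 2 * \<alpha> * \<beta>, - (\<alpha>\<^sup>2 - \<beta>\<^sup>2))"
    using grecu_ii_4_cases[OF assms] by metis
  have "peval P (x, y) = s * ((\<alpha>\<^sup>2 - \<beta>\<^sup>2) * (x\<^sup>2 - y\<^sup>2) + 2 * \<alpha> * \<beta> * (x * y))" for x y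
    by (simp add: P algebra_simps)
  then have ev: "\<bar>peval P (x, y)\<bar> = \<bar>(\<alpha>\<^sup>2 - \<beta>\<^sup>2) * (x\<^sup>2 - y\<^sup>2) + 2 * \<alpha> * \<beta> * (x * y)\<bar>" for x y
    using s by (auto simp: abs_mult)
  show ?thesis
  proof (rule poly_norm_4_eqI)
    fix x y :: real
    assume xy: "x ^ 4 + y ^ 4 \<le> 1"
    let ?Q = "(\<alpha>\<^sup>2 - \<beta>\<^sup>2) * (x\<^sup>2 - y\<^sup>2) + 2 * \<alpha> * \<beta> * (x * y)"
    \<comment> \<open>Lagrange's identity: the added square is the squared determinant of the two vectors.\<close>
    have "?Q\<^sup>2 \<le> ?Q\<^sup>2 + 2 * ((\<alpha>\<^sup>2 - \<beta>\<^sup>2) * (x * y) - \<alpha> * \<beta> * (x\<^sup>2 - y\<^sup>2))\<^sup>2" by simp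
    also have "\<dots> = (\<alpha> ^ 4 + \<beta> ^ 4) * (x ^ 4 + y ^ 4)"
      by (simp add: power2_eq_square power4_eq_xxxx algebra_simps)
    also have "\<dots> \<le> 1" using sphere xy by simp
    finally show "\<bar>peval P (x, y)\<bar> \<le> 1" unfolding ev by (simp add: abs_square_le_1)
  next
    have "(\<alpha>\<^sup>2 - \<beta>\<^sup>2) * (\<alpha>\<^sup>2 - \<beta>\<^sup>2) + 2 * \<alpha> * \<beta> * (\<alpha> * \<beta>) = \<alpha> ^ 4 + \<beta> ^ 4"
      by (simp add: power2_eq_square power4_eq_xxxx algebra_simps)
    then show "\<bar>peval P (\<alpha>, \<beta>)\<bar> = 1" unfolding ev sphere by simp
  qed (simp add: sphere)
qed

text \<open>
  Used twice: for the coefficient norm of family (ii), and for the constancy of the maximised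
  function.
\<close>

lemma family_ii_coeff_squares:
  fixes \<alpha> \<beta> :: real
  shows "2 * (\<alpha>\<^sup>2 - \<beta>\<^sup>2)\<^sup>2 + (2 * \<alpha> * \<beta>)\<^sup>2 = 2 * (\<alpha> ^ 4 + \<beta> ^ 4)"
  by (simp add: power2_eq_square power4_eq_xxxx algebra_simps)

lemma coeff_norm_grecu_ii_4:
  assumes "P \<in> grecu_ii 4"
  shows "coeff_norm 2 P = sqrt 2"
proof -
  obtain s \<alpha> \<beta> :: real where s: "s \<in> {1, -1}" and sphere: "\<alpha> ^ 4 + \<beta> ^ 4 = 1"
    and P: "P = s *\<^sub>R (\<alpha>\<^sup>2 - \<beta>\<^sup>2, 2 * \<alpha> * \<beta>, - (\<alpha>\<^sup>2 - \<beta>\<^sup>2))"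
    using grecu_ii_4_cases[OF assms] by metis
  have "P = (s * (\<alpha>\<^sup>2 - \<beta>\<^sup>2), s * (2 * \<alpha> * \<beta>), s * (- (\<alpha>\<^sup>2 - \<beta>\<^sup>2)))" by (simp add: P)
  moreover have "s\<^sup>2 = 1" using s by auto
  ultimately have "coeff_norm 2 P = sqrt ((\<alpha>\<^sup>2 - \<beta>\<^sup>2)\<^sup>2 + (2 * \<alpha> * \<beta>)\<^sup>2 + (- (\<alpha>\<^sup>2 - \<beta>\<^sup>2))\<^sup>2)"
    by (simp only: coeff_norm_2 power_mult_distrib [of s]) simp
  also have "\<dots> = sqrt (2 * (\<alpha>\<^sup>2 - \<beta>\<^sup>2)\<^sup>2 + (2 * \<alpha> * \<beta>)\<^sup>2)"
    by (simp only: power2_minus) simp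
  also have "\<dots> = sqrt 2" unfolding family_ii_coeff_squares sphere by simp
  finally show ?thesis .
qed

section \<open>The optimal constants\<close>

text \<open>Minimality of \<open>sqrt 2\<close> is witnessed by \<open>x\<^sup>2 - y\<^sup>2\<close>, the member of family (ii) with \<open>(\<alpha>, \<beta>) = (1, 0)\<close>.\<close>

lemma best_const_2_4: "best_const 2 4 = sqrt 2"
  unfolding best_const_def
proof (rule Least_equality)
  show "0 < sqrt 2 \<and> (\<forall>P. coeff_norm 2 P \<le> sqrt 2 * poly_norm 4 P)"
    using coeff_norm_le_sqrt2_poly_norm by simp
next
  fix K :: real
  assume K: "0 < K \<and> (\<forall>P. coeff_norm 2 P \<le> K * poly_norm 4 P)"
  have "(1, 0, - 1) \<in> grecu_ii 4"
    unfolding grecu_ii_def by (rule CollectI, rule exI[of _ 1], rule exI[of _ 1], rule exI[of _ 0]) simp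
  then show "sqrt 2 \<le> K"
    using K coeff_norm_grecu_ii_4 poly_norm_grecu_ii_4 by (metis mult.right_neutral)
qed

text \<open>
  With \<open>\<beta> = (1 - \<alpha>\<^sup>4)\<^bsup>1/4\<^esup>\<close> the quotient is
  \<open>(\<alpha>\<^sup>4 - \<beta>\<^sup>4) / (\<alpha>\<^sup>2 + \<beta>\<^sup>2) = \<alpha>\<^sup>2 - \<beta>\<^sup>2\<close>, so the value is the coefficient norm of a member of family (ii).
\<close>

lemma maximised_function_constant:
  fixes \<alpha> :: real
  assumes "\<alpha> \<in> {0..1}"
  shows "(2 * \<bar>(2 * \<alpha> ^ 4 - 1) / (\<alpha>\<^sup>2 + (1 - \<alpha> ^ 4) powr (1 / 2))\<bar>\<^sup>2
              + (2 * \<alpha> * (1 - \<alpha> ^ 4) powr (1 / 4))\<^sup>2) powr (1 / 2) = sqrt 2"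
proof -
  define \<beta> where "\<beta> = (1 - \<alpha> ^ 4) powr (1 / 4)"
  have nn: "0 \<le> 1 - \<alpha> ^ 4" using assms by (simp add: power_le_one)
  have \<beta>0: "0 \<le> \<beta>" by (simp add: \<beta>_def)
  have \<beta>4: "\<beta> ^ 4 = 1 - \<alpha> ^ 4"
  proof -
    have "\<beta> ^ 4 = \<beta> powr 4" using \<beta>0 by simp
    also have "\<dots> = 1 - \<alpha> ^ 4" unfolding \<beta>_def powr_powr using nn by simp
    finally show ?thesis .
  qed
  have \<beta>2: "(1 - \<alpha> ^ 4) powr (1 / 2) = \<beta>\<^sup>2"
  proof -
    have "\<beta>\<^sup>2 = \<beta> powr 2" using \<beta>0 by simp
    also have "\<dots> = (1 - \<alpha> ^ 4) powr (1 / 2)" unfolding \<beta>_def powr_powr by simp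
    finally show ?thesis by simp
  qed
  have sphere: "\<alpha> ^ 4 + \<beta> ^ 4 = 1" using \<beta>4 by simp
  then have nz: "\<alpha>\<^sup>2 + \<beta>\<^sup>2 \<noteq> 0" by (auto simp: sum_power2_eq_zero_iff)
  have "2 * \<alpha> ^ 4 - 1 = \<alpha> ^ 4 - \<beta> ^ 4" using sphere by simp
  also have "\<dots> = (\<alpha>\<^sup>2 - \<beta>\<^sup>2) * (\<alpha>\<^sup>2 + \<beta>\<^sup>2)"
    by (simp add: power2_eq_square power4_eq_xxxx algebra_simps)
  finally have "(2 * \<alpha> ^ 4 - 1) / (\<alpha>\<^sup>2 + \<beta>\<^sup>2) = \<alpha>\<^sup>2 - \<beta>\<^sup>2" using nz by simp
  then show ?thesis
    unfolding \<beta>2 \<beta>_def [symmetric] by (simp add: family_ii_coeff_squares sphere powr_half_sqrt)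
qed

theorem theorem4p2:
  shows "HL_D 4 = HL_C 4 \<and> HL_C 4 = K_2_2_4
    \<and> K_2_2_4 =
        (GREATEST m. m \<in> (\<lambda>\<alpha>::real.
            (2 * \<bar>(2 * \<alpha> ^ 4 - 1) / (\<alpha>\<^sup>2 + (1 - \<alpha> ^ 4) powr (1 / 2))\<bar>\<^sup>2
              + (2 * \<alpha> * (1 - \<alpha> ^ 4) powr (1 / 4))\<^sup>2) powr (1 / 2)) ` {0..1})
    \<and> (GREATEST m. m \<in> (\<lambda>\<alpha>::real.
            (2 * \<bar>(2 * \<alpha> ^ 4 - 1) / (\<alpha>\<^sup>2 + (1 - \<alpha> ^ 4) powr (1 / 2))\<bar>\<^sup>2
              + (2 * \<alpha> * (1 - \<alpha> ^ 4) powr (1 / 4))\<^sup>2) powr (1 / 2)) ` {0..1}) = sqrt 2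
    \<and> (\<forall>P \<in> grecu_ii 4. extremal P)
    \<and> (\<forall>P \<in> grecu_ii 4. coeff_norm 2 P = sqrt 2 * poly_norm 4 P)"
proof -
  have K: "K_2_2_4 = sqrt 2" by (simp only: K_2_2_4_def best_const_2_4)
  have "4 / (4 - 2) = (2::real)" and "ereal 4 = 4" by simp_all
  then have C: "HL_C 4 = sqrt 2" by (simp only: HL_C_def best_const_2_4)
  have D: "HL_D 4 = sqrt 2"
    unfolding HL_D_def using best_const_2_4 by simp
  let ?f = "\<lambda>\<alpha>::real.
            (2 * \<bar>(2 * \<alpha> ^ 4 - 1) / (\<alpha>\<^sup>2 + (1 - \<alpha> ^ 4) powr (1 / 2))\<bar>\<^sup>2
              + (2 * \<alpha> * (1 - \<alpha> ^ 4) powr (1 / 4))\<^sup>2) powr (1 / 2)"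
  have "?f ` {0..1} = (\<lambda>_. sqrt 2) ` {0..1::real}"
    by (rule image_cong[OF refl maximised_function_constant])
  also have "\<dots> = {sqrt 2}" by (simp add: image_constant_conv)
  finally have img: "?f ` {0..1} = {sqrt 2}" .
  have G: "(GREATEST m. m \<in> ?f ` {0..1}) = sqrt 2"
    unfolding img by (rule Greatest_equality) auto
  have eq: "coeff_norm 2 P = sqrt 2 * poly_norm 4 P" if "P \<in> grecu_ii 4" for P
    using coeff_norm_grecu_ii_4[OF that] poly_norm_grecu_ii_4[OF that] by simp
  show ?thesis
    unfolding G extremal_def K C D using eq by blast
qed

end
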